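(* For a positive integer $x$ let $F(x)$ be the number of positive integers $n$ such that $\lfloor x/n\rfloor$ is prime. Then $$F(x)=\mathcal{P}x+O\left(x^{1/2}\right),$$ that is, there is a constant $c>0$ such that $|F(x)-\mathcal{P}x|\le c\,x^{1/2}$ for all positive integers $x$, where $$\mathcal{P}=\sum_{n=1}^\infty\frac{\mathbf{1}_{\mathbb{P}}(n)}{n(n+1)}=\sum_{p}\frac{1}{p(p+1)}\cong 0.330230,$$ the last sum being over all primes $p$.
   Context: For a positive integer $x$, $\mathcal{F}(x)=\{n : \lfloor x/n\rfloor \text{ is prime}\}$ (with $n$ ranging over positive integers; necessarily $n\le x$) and $F(x)=|\mathcal{F}(x)|$. Here $\lfloor\cdot\rfloor$ is the floor function, and $\mathbf{1}_{\mathbb{P}}(m)=1$ if $m$ is prime and $0$ otherwise. The symbol $\cong$ denotes a numerical approximation. The notation $f(x)=O(g(x))$ means there is a constant $c>0$ with $|f(x)|\le c|g(x)|$ for all $x$. *)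

theory Defs
  imports Complex_Main "HOL-Computational_Algebra.Primes" "HOL-Analysis.Infinite_Sum"
begin

definition prime_quotients :: "nat \<Rightarrow> nat set" where
  "prime_quotients x = {n. n > 0 \<and> prime \<lfloor>real x / real n\<rfloor>}"

lemma prime_quotients_subset: "prime_quotients x \<subseteq> {1..x}"
proof
  fix n assume "n \<in> prime_quotients x"
  then have n: "n > 0" and "prime \<lfloor>real x / real n\<rfloor>"
    by (auto simp: prime_quotients_def)
  then have "0 < \<lfloor>real x / real n\<rfloor>"
    using prime_gt_0_int by blast
  then have "1 \<le> real x / real n"
    by (simp only: zero_less_floor)
  then have "real n \<le> real x"
    using n by (simp only: le_divide_eq_1_pos of_nat_0_less_iff)
  with n show "n \<in> {1..x}"
    by simp
qed

lemma finite_prime_quotients: "finite (prime_quotients x)"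
  using prime_quotients_subset finite_subset by blast

definition F :: "nat \<Rightarrow> nat" where
  "F x = card (prime_quotients x)"

definition prime_ind :: "nat \<Rightarrow> real" where
  "prime_ind m = (if prime m then 1 else 0)"

text \<open>The series over \<open>n \<ge> 1\<close> is shifted to start at index 0.\<close>

definition prime_series_term :: "nat \<Rightarrow> real" where
  "prime_series_term k = (let n = Suc k in prime_ind n / (real n * (real n + 1)))"

definition prime_const :: real where
  "prime_const = (\<Sum>k. prime_series_term k)"

end

theory Submission
  imports
    Defs
    "HOL-Analysis.Harmonic_Numbers"
    "HOL-Library.Discrete_Functions"
    "HOL-Real_Asymp.Real_Asymp"
begin

text \<open>
  For the error term, split the n counted by F(x) according to q = \<lfloor>x/n\<rfloor>. If q > \<surd>x then
  n \<le> \<surd>x, so there are at most \<surd>x such n. Each of the at most \<surd>x primes q \<le> \<surd>x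
  contributes x/(q(q+1)) + O(1), and the missing part of the series is at most x/\<surd>x.

  For the numerical value, the series converges too slowly to be summed directly. With
  a p = 1/(p(p+1)) one has 1 + a p = (1-p^-3)/(1-p^-2), so the Euler product gives
  \<Sum>p ln(1+a p) = ln(\<zeta>(2)/\<zeta>(3)), and the difference \<Sum>p (a p - ln(1+a p)) has terms of
  order p^-4; the primes up to 100 suffice for it.
\<close>

section \<open>The counting function\<close>

lemma prime_quotients_eq: "prime_quotients x = {n. n > 0 \<and> prime (x div n)}"
  by (simp add: prime_quotients_def floor_divide_of_nat_eq)

text \<open>The equation means \<open>n * q \<le> x < n * Suc q\<close>, and each half is a bound on
  \<open>n\<close>. Each fibre of the quotient map is thus a half-open interval, counted by a
  difference of two floors.\<close>

lemma div_eq_iff_greaterThanAtMost: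
  fixes x q n :: nat
  assumes "q > 0"
  shows "n > 0 \<and> x div n = q \<longleftrightarrow> n \<in> {x div Suc q<..x div q}"
proof (cases "n = 0")
  case False
  have "x div n = q \<longleftrightarrow> q \<le> x div n \<and> x div n < Suc q"
    by auto
  also have "\<dots> \<longleftrightarrow> n * q \<le> x \<and> x < n * Suc q"
    using False by (simp add: less_eq_div_iff_mult_less_eq div_less_iff_less_mult mult.commute)
  also have "\<dots> \<longleftrightarrow> n \<le> x div q \<and> x div Suc q < n"
    using assms by (metis div_less_iff_less_mult less_eq_div_iff_mult_less_eq zero_less_Suc)
  finally show ?thesis
    using False by auto
qed (use assms in auto)

text \<open>Both quantities are differences between the data at \<open>q\<close> and at
  \<open>Suc q\<close>, one with floors and one without. They differ by a difference of two
  fractional parts in [0, 1).\<close>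

lemma card_div_eq_approx:
  fixes x q :: nat
  assumes "q > 0"
  shows "\<bar>real (card {n. n > 0 \<and> x div n = q}) - real x / (real q * (real q + 1))\<bar> \<le> 1"
proof -
  have "{n. n > 0 \<and> x div n = q} = {x div Suc q<..x div q}"
    using div_eq_iff_greaterThanAtMost[OF assms] by blast
  hence "real (card {n. n > 0 \<and> x div n = q}) = real (x div q) - real (x div Suc q)"
    using assms by (simp add: of_nat_diff div_le_mono2)
  moreover have "real x / (real q * (real q + 1)) = real x / real q - real x / real (Suc q)"
    using assms by (simp add: field_simps)
  moreover have "0 \<le> real x / real m - real (x div m)" "real x / real m - real (x div m) < 1" for m
    using real_of_int_floor_add_one_gt[of "real x / real m"] of_int_floor_le[of "real x / real m"]
    by (simp_all add: floor_divide_of_nat_eq)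
  from this[of q] this[of "Suc q"] have
    "\<bar>(real (x div q) - real (x div Suc q)) - (real x / real q - real x / real (Suc q))\<bar> \<le> 1"
    by linarith
  ultimately show ?thesis
    by simp
qed

section \<open>Convergence and tails of the prime series\<close>

lemma sums_prime_series: "prime_series_term sums prime_const"
proof -
  have "summable (\<lambda>k. 1 / real (Suc k) ^ 2)"
    using inverse_power_summable[of 2, where 'a = real]
    by (subst summable_Suc_iff) (simp add: field_simps)
  moreover have "norm (prime_series_term k) \<le> 1 / real (Suc k) ^ 2" for k
    by (auto simp: prime_series_term_def prime_ind_def Let_def power2_eq_square
        intro!: divide_left_mono)
  ultimately have "summable prime_series_term"
    using summable_comparison_test' by blast
  thus ?thesis
    by (simp add: prime_const_def summable_sums)
qed

lemma prime_series_term_nonneg: "prime_series_term k \<ge> 0"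
  by (simp add: prime_series_term_def prime_ind_def Let_def)

lemma prime_series_term_le: "prime_series_term k \<le> 1 / real (Suc k) - 1 / real (Suc (Suc k))"
  by (simp add: prime_series_term_def prime_ind_def Let_def field_simps)

lemma sum_prime_series_term:
  "(\<Sum>k<n. prime_series_term k) = (\<Sum>p | prime p \<and> p \<le> n. 1 / (real p * (real p + 1)))"
proof -
  have "(\<Sum>k<n. prime_series_term k) = (\<Sum>m\<in>{1..n}. prime_ind m / (real m * (real m + 1)))"
    by (rule sum.reindex_bij_witness[of _ "\<lambda>m. m - 1" Suc])
      (auto simp: prime_series_term_def Let_def)
  also have "\<dots> = (\<Sum>p | prime p \<and> p \<le> n. 1 / (real p * (real p + 1)))"
    by (rule sum.mono_neutral_cong_right) (auto simp: prime_ind_def Suc_le_eq prime_gt_0_nat)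
  finally show ?thesis .
qed

text \<open>Dropping the primality condition leaves a telescoping series that dominates the
  tail.\<close>

lemma prime_const_tail:
  "prime_const - (\<Sum>k<n. prime_series_term k) \<in> {0..1 / real (Suc n)}"
proof -
  have *: "(\<lambda>k. 1 / real (Suc (k + n)) - 1 / real (Suc (Suc k + n))) sums (1 / real (Suc (0 + n)) - 0)"
    by (intro telescope_sums') real_asymp
  have "(\<lambda>k. prime_series_term (k + n)) sums (prime_const - (\<Sum>k<n. prime_series_term k))"
    by (intro sums_split_initial_segment sums_prime_series)
  hence "prime_const - (\<Sum>k<n. prime_series_term k) \<le> 1 / real (Suc (0 + n)) - 0"
    by (rule sums_le[rotated, OF _ *]) (use prime_series_term_le[of "_ + n"] in simp)
  moreover have "(\<Sum>k<n. prime_series_term k) \<le> prime_const"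
    unfolding prime_const_def
    by (rule sum_le_suminf) (use sums_prime_series prime_series_term_nonneg in \<open>auto simp: sums_iff\<close>)
  ultimately show ?thesis
    by simp
qed

lemma has_sum_prime_const:
  "((\<lambda>p::nat. 1 / (real p * (real p + 1))) has_sum prime_const) {p. prime p}"
proof -
  let ?f = "\<lambda>m. prime_ind m / (real m * (real m + 1))"
  have "?f sums prime_const"
    \<comment> \<open>Undoing the index shift adds only the term at 0, which vanishes because 0 is
      not prime.\<close>
    using sums_prime_series sums_Suc_iff[of ?f prime_const]
    by (simp add: prime_series_term_def[abs_def] Let_def)
  hence "(?f has_sum prime_const) UNIV"
    by (rule sums_nonneg_imp_has_sum) (simp add: prime_ind_def)
  thus ?thesis
    by (rule has_sum_cong_neutral[THEN iffD1, rotated -1]) (auto simp: prime_ind_def)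
qed

section \<open>The square-root error term\<close>

text \<open>The constant 3 collects one \<open>sqrt x\<close> from each of three sources: the
  \<open>n\<close> with a large quotient, the rounding errors over the small primes, and the tail of
  the series.\<close>

lemma F_bound: "\<bar>real (F x) - prime_const * real x\<bar> \<le> 3 * sqrt (real x)"
proof -
  define s where "s = floor_sqrt x"
  have s: "s ^ 2 \<le> x" "x < (Suc s) ^ 2"
    by (simp_all add: s_def Suc_floor_sqrt_power2_gt)
  have s1: "real s \<le> sqrt (real x)"
    by (rule real_le_rsqrt) (use s(1) in \<open>simp flip: of_nat_power\<close>)
  have s2: "sqrt (real x) \<le> real (Suc s)"
    by (rule real_le_lsqrt) (use s(2) in \<open>simp_all flip: of_nat_power del: of_nat_Suc\<close>)
  define Q where "Q = {q. prime q \<and> q \<le> s}"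
  define B where "B = {n \<in> prime_quotients x. x div n > s}"
  let ?C = "\<lambda>q. {n. n > 0 \<and> x div n = q}"
  have finQ: "finite Q" and cardQ: "card Q \<le> s"
  proof -
    have "Q \<subseteq> {1..s}"
      by (auto simp: Q_def Suc_le_eq prime_gt_0_nat)
    from finite_subset[OF this] card_mono[OF _ this] show "finite Q" "card Q \<le> s"
      by simp_all
  qed
  have Qpos: "q > 0" if "q \<in> Q" for q
    using that by (simp add: Q_def prime_gt_0_nat)
  \<comment> \<open>A quotient above \<open>s\<close> gives
    \<open>n * Suc s \<le> x < (Suc s)^2\<close>, so \<open>n\<close> is at most
    \<open>s\<close>.\<close>
  have "B \<subseteq> {1..s}"
  proof
    fix n assume "n \<in> B"
    hence n: "n > 0" "Suc s \<le> x div n"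
      by (auto simp: B_def prime_quotients_eq)
    have "n * Suc s \<le> x"
      using n by (simp add: less_eq_div_iff_mult_less_eq mult.commute)
    hence "n * Suc s < Suc s * Suc s"
      using s(2) by (simp add: power2_eq_square)
    hence "n < Suc s"
      unfolding mult_less_cancel2 by blast
    thus "n \<in> {1..s}"
      using n by simp
  qed
  from finite_subset[OF this] card_mono[OF _ this] have B: "finite B" "card B \<le> s"
    by simp_all
  have finC: "finite (?C q)" if "q \<in> Q" for q
    using div_eq_iff_greaterThanAtMost[OF Qpos[OF that]] by simp
  have "prime_quotients x = B \<union> (\<Union>q\<in>Q. ?C q)"
    by (auto simp: B_def Q_def prime_quotients_eq)
  moreover have "card (B \<union> (\<Union>q\<in>Q. ?C q)) = card B + card (\<Union>q\<in>Q. ?C q)"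
    using finQ finC B(1) by (intro card_Un_disjoint) (auto simp: B_def Q_def)
  moreover have "card (\<Union>q\<in>Q. ?C q) = (\<Sum>q\<in>Q. card (?C q))"
    using finQ finC by (intro card_UN_disjoint) auto
  ultimately have F: "F x = card B + (\<Sum>q\<in>Q. card (?C q))"
    by (simp add: F_def)
  define P where "P = (\<Sum>q\<in>Q. 1 / (real q * (real q + 1)))"
  have "\<bar>(\<Sum>q\<in>Q. real (card (?C q))) - real x * P\<bar> \<le>
      (\<Sum>q\<in>Q. \<bar>real (card (?C q)) - real x / (real q * (real q + 1))\<bar>)"
    unfolding P_def sum_distrib_left sum_subtractf[symmetric] mult_1_right times_divide_eq_right
    by (rule sum_abs)
  also have "\<dots> \<le> (\<Sum>q\<in>Q. 1)"
    by (intro sum_mono card_div_eq_approx Qpos)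
  also have "\<dots> \<le> real s"
    using cardQ by simp
  finally have main: "\<bar>(\<Sum>q\<in>Q. real (card (?C q))) - real x * P\<bar> \<le> real s" .
  have "prime_const - P \<in> {0..1 / real (Suc s)}"
    using prime_const_tail[of s] by (simp add: P_def Q_def sum_prime_series_term)
  hence "0 \<le> real x * (prime_const - P)" "real x * (prime_const - P) \<le> real x * (1 / real (Suc s))"
    by (simp, intro mult_left_mono) auto
  moreover have "real x * (1 / real (Suc s)) \<le> sqrt (real x)"
    using mult_left_mono[OF s2, of "sqrt (real x)"] by (simp add: pos_divide_le_eq)
  ultimately have "\<bar>real x * (prime_const - P)\<bar> \<le> sqrt (real x)"
    by linarith
  moreover have "real (F x) - prime_const * real x =
      real (card B) + ((\<Sum>q\<in>Q. real (card (?C q))) - real x * P) - real x * (prime_const - P)"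
    by (simp add: F algebra_simps)
  moreover have "real (card B) \<le> sqrt (real x)"
    using B(2) s1 by linarith
  ultimately show ?thesis
    using main s1 by linarith
qed

section \<open>Sieving the zeta series\<close>

text \<open>The bound is inclusive: in the usual terminology these are the (k+1)-rough numbers, and
  level 0 gives all positive integers.\<close>

definition rough :: "nat \<Rightarrow> nat set" where
  "rough k = {n. n > 0 \<and> (\<forall>p. prime p \<and> p \<le> k \<longrightarrow> \<not> p dvd n)}"

text \<open>For \<open>s \<ge> 2\<close> this is zeta(s) times the product of 1 - p^(-s) over the
  primes p up to \<open>k\<close>.\<close>

definition rough_zeta :: "nat \<Rightarrow> nat \<Rightarrow> real" where
  "rough_zeta s k = (\<Sum>\<^sub>\<infinity>n\<in>rough k. 1 / real n ^ s)"

lemma rough_Suc_not_prime: "\<not> prime (Suc k) \<Longrightarrow> rough (Suc k) = rough k"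
  by (auto simp: rough_def le_Suc_eq)

text \<open>One step of the sieve of Eratosthenes. The numbers removed form a dilate of the set
  being sieved, so their series is a multiple of the old one.\<close>

lemma rough_Suc_prime:
  assumes "prime (Suc k)"
  shows "rough (Suc k) = rough k - (\<lambda>n. Suc k * n) ` rough k" "(\<lambda>n. Suc k * n) ` rough k \<subseteq> rough k"
proof -
  have *: "\<not> q dvd Suc k * n" if "n \<in> rough k" "prime q" "q \<le> k" for q n
  proof
    assume "q dvd Suc k * n"
    hence "q dvd Suc k \<or> q dvd n"
      using \<open>prime q\<close> by (simp add: prime_dvd_mult_iff del: mult_Suc)
    thus False
      using that assms primes_dvd_imp_eq[of q "Suc k"] by (auto simp: rough_def)
  qed
  thus "(\<lambda>n. Suc k * n) ` rough k \<subseteq> rough k"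
    by (auto simp: rough_def simp del: mult_Suc)
  show "rough (Suc k) = rough k - (\<lambda>n. Suc k * n) ` rough k"
  proof (intro equalityI subsetI)
    fix n assume "n \<in> rough (Suc k)"
    thus "n \<in> rough k - (\<lambda>n. Suc k * n) ` rough k"
      using assms by (auto simp: rough_def simp del: mult_Suc)
  next
    fix n assume n: "n \<in> rough k - (\<lambda>n. Suc k * n) ` rough k"
    have "\<not> Suc k dvd n"
    proof
      assume "Suc k dvd n"
      then obtain m where m: "n = Suc k * m" ..
      hence "m \<in> rough k"
        using n by (auto simp: rough_def simp del: mult_Suc)
      thus False
        using m n by blast
    qed
    thus "n \<in> rough (Suc k)"
      using n by (auto simp: rough_def le_Suc_eq)
  qed
qed

context
  fixes s :: nat
  assumes s: "s \<ge> 2"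
begin

lemma has_sum_zeta: "((\<lambda>n. 1 / real n ^ s) has_sum (\<Sum>n. 1 / real n ^ s)) UNIV"
  using inverse_power_summable[OF s, where 'a = real]
  by (intro sums_nonneg_imp_has_sum summable_sums) (simp_all add: field_simps)

lemma summable_on_zeta: "(\<lambda>n. 1 / real n ^ s) summable_on A"
  using has_sum_zeta summable_on_subset[of _ UNIV A] by (auto simp: summable_on_def)

lemma rough_zeta_0: "rough_zeta s 0 = (\<Sum>n. 1 / real n ^ s)"
proof -
  have "rough_zeta s 0 = (\<Sum>\<^sub>\<infinity>n. 1 / real n ^ s)"
    \<comment> \<open>The index 0, absent from \<open>rough 0\<close>, adds nothing to the full sum:
      \<open>1 / 0 = 0\<close>.\<close>
    unfolding rough_zeta_def using s by (intro infsum_cong_neutral) (auto simp: rough_def)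
  thus ?thesis
    using has_sum_zeta by (simp add: infsumI)
qed

text \<open>Dilating by the prime \<open>Suc k\<close> scales the series by
  \<open>1 / real (Suc k) ^ s\<close>, and this portion is removed. At a composite index or at 1 the
  factor is 1.\<close>

lemma rough_zeta_Suc:
  "rough_zeta s (Suc k) = (1 - prime_ind (Suc k) / real (Suc k) ^ s) * rough_zeta s k"
proof (cases "prime (Suc k)")
  case True
  have "rough_zeta s (Suc k) = rough_zeta s k - (\<Sum>\<^sub>\<infinity>n\<in>(\<lambda>n. Suc k * n) ` rough k. 1 / real n ^ s)"
    unfolding rough_zeta_def rough_Suc_prime(1)[OF True]
    using rough_Suc_prime(2)[OF True] by (intro infsum_Diff summable_on_zeta)
  also have "(\<Sum>\<^sub>\<infinity>n\<in>(\<lambda>n. Suc k * n) ` rough k. 1 / real n ^ s) =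
      (\<Sum>\<^sub>\<infinity>n\<in>rough k. 1 / real (Suc k) ^ s * (1 / real n ^ s))"
    by (subst infsum_reindex)
      (auto simp: inj_on_def o_def power_mult_distrib simp del: mult_Suc of_nat_Suc)
  also have "\<dots> = 1 / real (Suc k) ^ s * rough_zeta s k"
    unfolding rough_zeta_def by (rule infsum_cmult_right) (rule summable_on_zeta)
  finally show ?thesis
    using True by (simp add: prime_ind_def algebra_simps)
qed (simp add: rough_zeta_def rough_Suc_not_prime prime_ind_def)

text \<open>The number 1 always survives, and any other survivor has a prime factor above
  \<open>k\<close>. The rest of the sum is therefore bounded by the zeta tail from
  \<open>Suc k\<close> on.\<close>

lemma rough_zeta_bounds:
  "1 \<le> rough_zeta s k" "rough_zeta s k \<le> 1 + ((\<Sum>n. 1 / real n ^ s) - (\<Sum>n<Suc k. 1 / real n ^ s))"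
proof -
  have "1 \<in> rough k"
    by (auto simp: rough_def)
  have split: "rough_zeta s k = 1 + (\<Sum>\<^sub>\<infinity>n\<in>rough k - {1}. 1 / real n ^ s)"
    unfolding rough_zeta_def using \<open>1 \<in> rough k\<close> summable_on_zeta
    by (subst infsum_Diff) auto
  have "(\<Sum>\<^sub>\<infinity>n\<in>rough k - {1}. 1 / real n ^ s) \<ge> 0"
    by (rule infsum_nonneg) simp
  thus "1 \<le> rough_zeta s k"
    using split by simp
  have "n \<notin> {..<Suc k}" if "n \<in> rough k - {1}" for n
  proof
    assume "n \<in> {..<Suc k}"
    have "\<exists>p. prime p \<and> p dvd n"
      by (rule prime_factor_nat) (use that in blast)
    then obtain p where "prime p" "p dvd n"
      by blast
    moreover have "p \<le> n"
      using that \<open>p dvd n\<close> by (auto simp: rough_def intro: dvd_imp_le)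
    ultimately show False
      using that \<open>n \<in> {..<Suc k}\<close> by (auto simp: rough_def)
  qed
  hence "(\<Sum>\<^sub>\<infinity>n\<in>rough k - {1}. 1 / real n ^ s) \<le> (\<Sum>\<^sub>\<infinity>n\<in>UNIV - {..<Suc k}. 1 / real n ^ s)"
    by (intro infsum_mono_neutral summable_on_zeta) auto
  also have "\<dots> = (\<Sum>n. 1 / real n ^ s) - (\<Sum>n<Suc k. 1 / real n ^ s)"
    using has_sum_zeta
    by (subst infsum_Diff) (auto simp: infsumI intro: summable_on_zeta simp del: sum.lessThan_Suc)
  finally show "rough_zeta s k \<le> 1 + ((\<Sum>n. 1 / real n ^ s) - (\<Sum>n<Suc k. 1 / real n ^ s))"
    using split by simp
qed

text \<open>Together with the recursion in \<open>k\<close>, this amounts to the Euler product of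
  zeta(s).\<close>

lemma rough_zeta_tendsto: "rough_zeta s \<longlonglongrightarrow> 1"
proof (rule tendsto_sandwich[OF _ _ tendsto_const])
  have "(\<lambda>k. \<Sum>n<Suc k. 1 / real n ^ s) \<longlonglongrightarrow> (\<Sum>n. 1 / real n ^ s)"
    using has_sum_imp_sums[OF has_sum_zeta] unfolding sums_def by (rule LIMSEQ_Suc)
  hence "(\<lambda>k. 1 + ((\<Sum>n. 1 / real n ^ s) - (\<Sum>n<Suc k. 1 / real n ^ s))) \<longlonglongrightarrow>
      1 + ((\<Sum>n. 1 / real n ^ s) - (\<Sum>n. 1 / real n ^ s))"
    by (intro tendsto_intros)
  thus "(\<lambda>k. 1 + ((\<Sum>n. 1 / real n ^ s) - (\<Sum>n<Suc k. 1 / real n ^ s))) \<longlonglongrightarrow> 1"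
    by simp
qed (use rough_zeta_bounds in \<open>auto simp del: sum.lessThan_Suc\<close>)

end

text \<open>A quotient-free form suited to induction: each step multiplies both sides by
  \<open>1 - prime_ind (Suc n) / real (Suc n) ^ 3\<close>.\<close>

lemma prod_prime_series_term:
  "(\<Prod>k<n. 1 + prime_series_term k) * rough_zeta 2 n * rough_zeta 3 0 =
     rough_zeta 3 n * rough_zeta 2 0"
proof (induction n)
  case (Suc n)
  \<comment> \<open>At a prime p this is (p^2+p+1)(p-1) = p^3-1 after cancelling p+1.\<close>
  have *: "(1 + prime_series_term n) * (1 - prime_ind (Suc n) / real (Suc n) ^ 2) =
      1 - prime_ind (Suc n) / real (Suc n) ^ 3"
    by (simp add: prime_series_term_def prime_ind_def Let_def divide_simps) algebra
  have "(\<Prod>k<Suc n. 1 + prime_series_term k) * rough_zeta 2 (Suc n) * rough_zeta 3 0 =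
      ((1 + prime_series_term n) * (1 - prime_ind (Suc n) / real (Suc n) ^ 2)) *
      ((\<Prod>k<n. 1 + prime_series_term k) * rough_zeta 2 n * rough_zeta 3 0)"
    by (simp add: rough_zeta_Suc)
  also have "\<dots> = rough_zeta 3 (Suc n) * rough_zeta 2 0"
    unfolding Suc.IH * by (simp add: rough_zeta_Suc)
  finally show ?case .
qed simp

lemma prod_prime_series_term_tendsto:
  "(\<lambda>n. \<Prod>k<n. 1 + prime_series_term k) \<longlonglongrightarrow> (\<Sum>n. 1 / real n ^ 2) / (\<Sum>n. 1 / real n ^ 3)"
proof -
  have pos: "rough_zeta 2 n \<noteq> 0" "rough_zeta 3 n \<noteq> 0" for n
    using rough_zeta_bounds(1)[of 2 n] rough_zeta_bounds(1)[of 3 n] by auto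
  have eq: "(\<Prod>k<n. 1 + prime_series_term k) =
      rough_zeta 3 n / rough_zeta 2 n * (rough_zeta 2 0 / rough_zeta 3 0)" for n
    using prod_prime_series_term[of n] pos by (simp add: field_simps)
  have "(\<lambda>n. rough_zeta 3 n / rough_zeta 2 n * (rough_zeta 2 0 / rough_zeta 3 0)) \<longlonglongrightarrow>
      1 / 1 * (rough_zeta 2 0 / rough_zeta 3 0)"
    by (intro tendsto_intros rough_zeta_tendsto) simp_all
  thus ?thesis
    by (simp add: eq rough_zeta_0)
qed

section \<open>Numerical evaluation\<close>

text \<open>The differences of \<open>h\<close> telescope to \<open>h N\<close>, and the permitted
  errors telescope to \<open>c / real N\<close>.\<close>

lemma suminf_tail_bounds:
  fixes f h :: "nat \<Rightarrow> real"
  assumes "summable f" "h \<longlonglongrightarrow> 0" "N > 0"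
    and upper: "\<And>n. n \<ge> N \<Longrightarrow> f n \<le> h n - h (Suc n)"
    and lower: "\<And>n. n \<ge> N \<Longrightarrow> h n - h (Suc n) - c * (1 / real n - 1 / real (Suc n)) \<le> f n"
  shows "suminf f - (\<Sum>n<N. f n) \<in> {h N - c / real N..h N}"
proof -
  have f: "(\<lambda>n. f (n + N)) sums (suminf f - (\<Sum>n<N. f n))"
    by (intro sums_split_initial_segment summable_sums assms)
  have h: "(\<lambda>n. h (n + N) - h (Suc n + N)) sums (h (0 + N) - 0)"
    by (intro telescope_sums' LIMSEQ_ignore_initial_segment assms)
  have "(\<lambda>n. 1 / real (n + N) - 1 / real (Suc n + N)) sums (1 / real (0 + N) - 0)"
    by (intro telescope_sums') real_asymp
  from sums_diff[OF h sums_mult[OF this, of c]] have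
    "h (0 + N) - 0 - c * (1 / real (0 + N) - 0) \<le> suminf f - (\<Sum>n<N. f n)"
    by (rule sums_le[rotated, OF _ f]) (use lower[of "_ + N"] in simp)
  moreover have "suminf f - (\<Sum>n<N. f n) \<le> h (0 + N) - 0"
    by (rule sums_le[OF _ f h]) (use upper[of "_ + N"] in simp)
  ultimately show ?thesis
    by simp
qed

text \<open>The telescoping functions are the Euler--Maclaurin expansions of the two zeta tails.\<close>

lemma telescope_zeta_2:
  fixes x :: real
  assumes "x > 0"
  shows "1/x + 1/(2*x^2) + 1/(6*x^3) - (1/(x+1) + 1/(2*(x+1)^2) + 1/(6*(x+1)^3)) =
    1/x^2 + 1/(6*x^2*(x+1)^2) * (1/x - 1/(x+1))"
  using assms by (simp add: divide_simps) algebra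

lemma telescope_zeta_3:
  fixes x :: real
  assumes "x > 0"
  shows "1/(2*x^2) + 1/(2*x^3) + 1/(4*x^4) - (1/(2*(x+1)^2) + 1/(2*(x+1)^3) + 1/(4*(x+1)^4)) =
    1/x^3 + (2*x+1)/(4*x^3*(x+1)^3) * (1/x - 1/(x+1))"
  using assms by (simp add: divide_simps) algebra

text \<open>The terms below 20 are summed exactly; the tail is then known up to 1/10^6/20 =
  5/10^8.\<close>

lemma zeta_2_bounds: "(\<Sum>n. 1 / real n ^ 2) \<in> {1.64493402..1.64493408}"
proof -
  let ?h = "\<lambda>n::nat. 1 / real n + 1 / (2 * real n ^ 2) + 1 / (6 * real n ^ 3)"
  have "?h n - ?h (Suc n) \<in> {1 / real n ^ 2..1 / real n ^ 2 + 1 / 10 ^ 6 * (1 / real n - 1 / real (Suc n))}"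
    if n: "n \<ge> 20" for n
  proof -
    let ?d = "1 / real n - 1 / real (Suc n)"
    have eq: "?h n - ?h (Suc n) = 1 / real n ^ 2 + 1 / (6 * real n ^ 2 * (real n + 1) ^ 2) * ?d"
      using telescope_zeta_2[of "real n"] n by (simp add: add.commute)
    \<comment> \<open>The left side is 1058400, just above 10^6.\<close>
    have "6 * 20 ^ 2 * (20 + 1) ^ 2 \<le> 6 * real n ^ 2 * (real n + 1) ^ 2"
      using n by (intro mult_mono power_mono) auto
    hence "1 / (6 * real n ^ 2 * (real n + 1) ^ 2) \<le> 1 / 10 ^ 6"
      by (intro divide_left_mono) (use n in auto)
    moreover have d: "?d \<ge> 0"
      using n by (simp add: frac_le)
    ultimately have "1 / (6 * real n ^ 2 * (real n + 1) ^ 2) * ?d \<le> 1 / 10 ^ 6 * ?d"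
      by (rule mult_right_mono)
    moreover have "1 / (6 * real n ^ 2 * (real n + 1) ^ 2) * ?d \<ge> 0"
      using d by simp
    ultimately show ?thesis
      unfolding eq by simp
  qed
  hence "?h n - ?h (Suc n) - 1 / 10 ^ 6 * (1 / real n - 1 / real (Suc n)) \<le> 1 / real n ^ 2"
    "1 / real n ^ 2 \<le> ?h n - ?h (Suc n)" if "n \<ge> 20" for n
    using that by (force simp del: of_nat_Suc)+
  moreover have "?h \<longlonglongrightarrow> 0"
    by real_asymp
  moreover have "summable (\<lambda>n. 1 / real n ^ 2)"
    using has_sum_imp_sums[OF has_sum_zeta[of 2]] by (simp add: sums_iff)
  ultimately have "(\<Sum>n. 1 / real n ^ 2) - (\<Sum>n<20. 1 / real n ^ 2) \<in>
      {?h 20 - 1 / 10 ^ 6 / real 20..?h 20}"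
    by (intro suminf_tail_bounds) simp_all
  thus ?thesis
    \<comment> \<open>Rewriting the index range as an explicit list lets \<open>simp\<close>
      evaluate the partial sum as a rational number.\<close>
    unfolding lessThan_atLeast0 atLeastLessThan_upt sum_set_upt_conv_sum_list_nat
    by (simp add: upt_rec[of 0 20] upt_rec[of "Suc 0" 20] upt_rec_numeral flip: numeral_2_eq_2)
qed

lemma zeta_3_bounds: "(\<Sum>n. 1 / real n ^ 3) \<in> {1.20205689..1.20205691}"
proof -
  let ?h = "\<lambda>n::nat. 1 / (2 * real n ^ 2) + 1 / (2 * real n ^ 3) + 1 / (4 * real n ^ 4)"
  have "?h n - ?h (Suc n) \<in> {1 / real n ^ 3..1 / real n ^ 3 + 2 / 10 ^ 7 * (1 / real n - 1 / real (Suc n))}"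
    if n: "n \<ge> 20" for n
  proof -
    let ?d = "1 / real n - 1 / real (Suc n)"
    have eq: "?h n - ?h (Suc n) =
        1 / real n ^ 3 + (2 * real n + 1) / (4 * real n ^ 3 * (real n + 1) ^ 3) * ?d"
      using telescope_zeta_3[of "real n"] n by (simp add: add.commute)
    \<comment> \<open>The left side is 7056000, which exceeds 10^7/2. The power of
      \<open>n + 1\<close> drops to 2 because \<open>2 * n + 1\<close> is bounded by
      \<open>2 * (n + 1)\<close>.\<close>
    have "2 * 20 ^ 3 * (20 + 1) ^ 2 \<le> 2 * real n ^ 3 * (real n + 1) ^ 2"
      using n by (intro mult_mono power_mono) auto
    have "(2 * real n + 1) / (4 * real n ^ 3 * (real n + 1) ^ 3) \<le>
        (2 * (real n + 1)) / (4 * real n ^ 3 * (real n + 1) ^ 3)"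
      by (intro divide_right_mono) auto
    also have "\<dots> = 1 / (2 * real n ^ 3 * (real n + 1) ^ 2)"
      using n by (simp add: divide_simps) algebra
    also have "\<dots> \<le> 2 / 10 ^ 7"
      using \<open>2 * 20 ^ 3 * (20 + 1) ^ 2 \<le> _\<close> n by (simp add: field_simps)
    finally have "(2 * real n + 1) / (4 * real n ^ 3 * (real n + 1) ^ 3) \<le> 2 / 10 ^ 7" .
    moreover have d: "?d \<ge> 0"
      using n by (simp add: frac_le)
    ultimately have "(2 * real n + 1) / (4 * real n ^ 3 * (real n + 1) ^ 3) * ?d \<le> 2 / 10 ^ 7 * ?d"
      by (rule mult_right_mono)
    moreover have "(2 * real n + 1) / (4 * real n ^ 3 * (real n + 1) ^ 3) * ?d \<ge> 0"
      using d by (intro mult_nonneg_nonneg) auto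
    ultimately show ?thesis
      unfolding eq by simp
  qed
  hence "?h n - ?h (Suc n) - 2 / 10 ^ 7 * (1 / real n - 1 / real (Suc n)) \<le> 1 / real n ^ 3"
    "1 / real n ^ 3 \<le> ?h n - ?h (Suc n)" if "n \<ge> 20" for n
    using that by (force simp del: of_nat_Suc)+
  moreover have "?h \<longlonglongrightarrow> 0"
    by real_asymp
  moreover have "summable (\<lambda>n. 1 / real n ^ 3)"
    using has_sum_imp_sums[OF has_sum_zeta[of 3]] by (simp add: sums_iff)
  ultimately have "(\<Sum>n. 1 / real n ^ 3) - (\<Sum>n<20. 1 / real n ^ 3) \<in>
      {?h 20 - 2 / 10 ^ 7 / real 20..?h 20}"
    by (intro suminf_tail_bounds) simp_all
  thus ?thesis
    unfolding lessThan_atLeast0 atLeastLessThan_upt sum_set_upt_conv_sum_list_nat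
    by (simp add: upt_rec[of 0 20] upt_rec[of "Suc 0" 20] upt_rec_numeral flip: numeral_2_eq_2)
qed

section \<open>Partial sum and product over the primes up to 100\<close>

lemma primes_le_100:
  "{p::nat. prime p \<and> p \<le> 100} =
     set [2, 3, 5, 7, 11, 13, 17, 19, 23, 29, 31, 37, 41, 43, 47, 53, 59, 61, 67, 71, 73, 79, 83, 89, 97]"
  (is "_ = set ?ps")
proof -
  have "filter prime [0..<101::nat] = ?ps"
    by code_simp
  moreover have "{p::nat. prime p \<and> p \<le> 100} = set (filter prime [0..<101])"
    by auto
  ultimately show ?thesis
    by (simp only:)
qed

lemma sum_prime_series_100:
  "(\<Sum>k<100. prime_series_term k) \<in> {0.328421364540..0.328421364541}"
  unfolding sum_prime_series_term primes_le_100 by simp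

lemma prod_prime_series_100:
  "(\<Prod>k<100. 1 + prime_series_term k) \<in> {1.36596016781..1.36596016782}"
proof -
  have "(\<Prod>k<100. 1 + prime_series_term k) =
      (\<Prod>m\<in>{1..100}. 1 + prime_ind m / (real m * (real m + 1)))"
    by (rule prod.reindex_bij_witness[of _ "\<lambda>m. m - 1" Suc])
      (auto simp: prime_series_term_def Let_def)
  also have "\<dots> = (\<Prod>p | prime p \<and> p \<le> 100. 1 + 1 / (real p * (real p + 1)))"
    by (rule prod.mono_neutral_cong_right) (auto simp: prime_ind_def Suc_le_eq prime_gt_0_nat)
  finally show ?thesis
    unfolding primes_le_100 by simp
qed

section \<open>Logarithms and the six-decimal value\<close>

text \<open>Bounds each term \<open>a - ln (1 + a)\<close> of the correction series by half of a
  square.\<close>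

lemma ln_one_plus_ge_quadratic:
  fixes x :: real
  assumes "x \<ge> 0"
  shows "x - x\<^sup>2 / 2 \<le> ln (1 + x)"
proof (cases "x = 0")
  case False
  \<comment> \<open>This is the first term of the series of ln in powers of (t-1)/(t+1), at t = 1 +
    x.\<close>
  have "2 * (x / (2 + x)) \<le> ln (1 + x)"
    using ln_approx_bounds[of "1 + x" 1] assms False by (simp add: add.commute)
  moreover have "x - x\<^sup>2 / 2 \<le> 2 * (x / (2 + x))"
    using assms by (simp add: field_simps power2_eq_square)
  ultimately show ?thesis
    by linarith
qed simp

text \<open>This difference is the sum of ln(1 + a p) over the primes above 100. Merged into a
  single logarithm, its argument is so close to 1 that one term of the series suffices.\<close>

lemma ln_quotient_bounds:
  "ln ((\<Sum>n. 1 / real n ^ 2) / (\<Sum>n. 1 / real n ^ 3)) - ln (\<Prod>k<100. 1 + prime_series_term k) \<in>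
     {0.0018083..0.0018086}"
proof -
  define z2 :: real where "z2 = (\<Sum>n. 1 / real n ^ 2)"
  define z3 :: real where "z3 = (\<Sum>n. 1 / real n ^ 3)"
  define D where "D = (\<Prod>k<100. 1 + prime_series_term k)"
  note b = zeta_2_bounds[folded z2_def] zeta_3_bounds[folded z3_def]
    prod_prime_series_100[folded D_def]
  have pos: "z2 > 0" "z3 > 0" "D > 0"
    using b by auto
  have "1.20205689 * 1.36596016781 \<le> z3 * D" "z3 * D \<le> 1.20205691 * 1.36596016782"
    using b pos by (intro mult_mono; simp)+
  hence "z2 / (z3 * D) \<ge> 1.00181012" "z2 / (z3 * D) \<le> 1.00181019"
    using b pos by (simp_all add: pos_le_divide_eq pos_divide_le_eq)
  hence "ln 1.00181012 \<le> ln (z2 / (z3 * D))" "ln (z2 / (z3 * D)) \<le> ln 1.00181019"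
    by (auto intro!: ln_mono divide_pos_pos mult_pos_pos pos)
  moreover have "ln 1.00181012 \<ge> (0.0018083 :: real)"
    using ln_approx_bounds[of "1.00181012" 1] by simp
  moreover have "ln 1.00181019 \<le> (0.0018086 :: real)"
    using ln_approx_bounds[of "1.00181019" 1] by (simp add: power3_eq_cube power2_eq_square)
  moreover have "ln (z2 / (z3 * D)) = ln (z2 / z3) - ln D"
    using pos by (simp add: ln_div ln_mult)
  ultimately show ?thesis
    unfolding z2_def[symmetric] z3_def[symmetric] D_def[symmetric] by simp
qed

lemma prime_const_numeric: "\<bar>prime_const - 0.330230\<bar> < 5 / 10 ^ 7"
proof -
  let ?a = prime_series_term
  let ?f = "\<lambda>k. ?a k - ln (1 + ?a k)"
  let ?z = "(\<Sum>n. 1 / real n ^ 2) / (\<Sum>n. 1 / real n ^ 3) :: real"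
  have ln_prod: "(\<Sum>k<n. ln (1 + ?a k)) = ln (\<Prod>k<n. 1 + ?a k)" for n
    using prime_series_term_nonneg by (subst ln_prod) (auto simp: add_nonneg_eq_0_iff)
  have "?z > 0"
    using zeta_2_bounds zeta_3_bounds by (intro divide_pos_pos) auto
  hence "(\<lambda>n. (\<Sum>k<n. ?a k) - ln (\<Prod>k<n. 1 + ?a k)) \<longlonglongrightarrow> prime_const - ln ?z"
    using sums_prime_series unfolding sums_def
    by (intro tendsto_diff tendsto_ln prod_prime_series_term_tendsto) auto
  hence f: "?f sums (prime_const - ln ?z)"
    unfolding sums_def by (simp add: sum_subtractf ln_prod)
  \<comment> \<open>The constant is half of 1/(100 * 100): one factor of the square of
    \<open>?a n\<close> is bounded by 1/(100 * 100), the other by the telescoping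
    \<open>1 / (n * Suc n)\<close>.\<close>
  have "?f n \<in> {0..1 / 20000 * (1 / real n - 1 / real (Suc n))}" if n: "n \<ge> 100" for n
  proof -
    have "?a n \<le> 1 / (real (Suc n) * real (Suc (Suc n)))"
      by (simp add: prime_series_term_def prime_ind_def Let_def algebra_simps)
    also have "\<dots> \<le> 1 / (real n * real (Suc n))"
      using n by (intro divide_left_mono) auto
    finally have 1: "?a n \<le> 1 / (real n * real (Suc n))" .
    also have "\<dots> \<le> 1 / (100 * 100)"
      using n by (intro divide_left_mono mult_mono) auto
    finally have "?a n * ?a n \<le> 1 / (100 * 100) * (1 / (real n * real (Suc n)))"
      using 1 prime_series_term_nonneg[of n] by (intro mult_mono) auto
    also have "1 / (real n * real (Suc n)) = 1 / real n - 1 / real (Suc n)"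
      using n by (simp add: field_simps)
    finally show ?thesis
      using ln_one_plus_ge_quadratic[OF prime_series_term_nonneg[of n]]
        ln_add_one_self_le_self[OF prime_series_term_nonneg[of n]]
      by (simp add: power2_eq_square del: of_nat_Suc)
  qed
  hence bounds: "0 \<le> ?f n" "?f n \<le> 1 / 20000 * (1 / real n) - 1 / 20000 * (1 / real (Suc n))"
    if "n \<ge> 100" for n
    unfolding right_diff_distrib[symmetric] using that by (auto simp del: of_nat_Suc)
  \<comment> \<open>Choosing \<open>c\<close> equal to the constant in \<open>h\<close> makes the
    lower endpoint 0; the upper one is 5/10^7.\<close>
  have "suminf ?f - (\<Sum>k<100. ?f k) \<in>
      {1 / 20000 * (1 / real 100) - 1 / 20000 / real 100..1 / 20000 * (1 / real 100)}"
  proof (rule suminf_tail_bounds[where h = "\<lambda>n. 1 / 20000 * (1 / real n)"])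
    show "(\<lambda>n. 1 / 20000 * (1 / real n)) \<longlonglongrightarrow> 0"
      by real_asymp
  qed (use f bounds in \<open>simp_all only: right_diff_distrib sums_iff, simp_all\<close>)
  moreover have "(\<Sum>k<100. ?f k) = (\<Sum>k<100. ?a k) - ln (\<Prod>k<100. 1 + ?a k)"
    by (simp only: sum_subtractf ln_prod)
  ultimately have "prime_const - (\<Sum>k<100. ?a k) - (ln ?z - ln (\<Prod>k<100. 1 + ?a k)) \<in> {0..5 / 10 ^ 7}"
    using f by (simp add: sums_iff)
  \<comment> \<open>Adding the three intervals places \<open>P\<close> between 0.330229664540 and
    0.330230464541.\<close>
  moreover have "\<bar>P - 0.330230\<bar> < 5 / 10 ^ 7"
    if "P - A - L \<in> {0..5 / 10 ^ 7}" "L \<in> {0.0018083..0.0018086}"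
      "A \<in> {0.328421364540..0.328421364541}" for P A L :: real
    using that unfolding abs_less_iff by auto
  ultimately show ?thesis
    using ln_quotient_bounds sum_prime_series_100 by blast
qed

text \<open>The numerical approximation is read as correct rounding to six decimals:
  \<open>5 / 10 ^ 7\<close> is half a unit in the sixth place.\<close>

theorem theorem5:
  shows "(\<exists>c::real. c > 0 \<and>
            (\<forall>x::nat. x > 0 \<longrightarrow>
               \<bar>real (F x) - prime_const * real x\<bar> \<le> c * real x powr (1/2)))
       \<and> prime_series_term sums prime_const
       \<and> ((\<lambda>p::nat. 1 / (real p * (real p + 1))) has_sum prime_const) {p. prime p}
       \<and> \<bar>prime_const - 0.330230\<bar> < 5 / 10 ^ 7"
  using F_bound sums_prime_series has_sum_prime_const prime_const_numeric
  by (intro conjI exI[of _ 3]) (simp_all add: powr_half_sqrt)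

end
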